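(* Let $p$ be a prime number, $S=\mathbb{Z}$ and $T=\{1,p,\ldots,p^k,\ldots\}$ the set of powers of $p$. Then for every positive integer $k$, $$\frac{{k!}_T}{{k!}_S}=f_{k-1}\big(X(\mathbb{F}_p^k)\big).$$
   Context: $X(\mathbb{F}_p^n)$ is the simplicial complex whose vertices are the nonzero vectors of $\mathbb{F}_p^n$ and whose simplices are the linearly independent (unimodular) subsets of $\mathbb{F}_p^n$; $f_i(K)$ denotes the number of $i$-dimensional simplices (those with $i+1$ vertices) of a simplicial complex $K$. Let $S$ be an infinite subset of $\mathbb{Z}$ and $\ell$ a prime. An $\ell$-ordering on $S$ is a sequence $(a_k)_{k\ge 0}$ of elements of $S$ such that $a_0\in S$ is arbitrary and, for every $k\geq 1$, $a_k\in S$ is chosen to minimise the highest power of $\ell$ dividing $(a_k-a_{k-1})\cdots(a_k-a_1)(a_k-a_0)$. Let $\nu_k(S,\ell)$ be the highest power of $\ell$ (as an integer $\ell^e$) dividing $(a_k-a_{k-1})\cdots(a_k-a_0)$; it is independent of the choice of $\ell$-ordering (Bhargava). Bhargava's generalised factorial is ${k!}_S=\prod_{\ell}\nu_k(S,\ell)$, the product over all primes $\ell$. *)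

theory Defs
  imports
    "HOL-Library.Extended_Nat"
    "HOL-Library.Groups_Big_Fun"
    "Jordan_Normal_Form.VS_Connect"
    "Berlekamp_Zassenhaus.Finite_Field"
begin

section \<open>Bhargava's generalised factorial\<close>

text \<open>
  The library's \<^const>\<open>multiplicity\<close> satisfies \<open>multiplicity l 0 = 0\<close>, whereas every power of
  \<open>l\<close> divides \<open>0\<close>.  The exponent is therefore taken in \<^typ>\<open>enat\<close>; otherwise repeating an
  earlier term would look like a minimising choice in an \<open>l\<close>-ordering.
\<close>

definition val_exp :: "nat \<Rightarrow> int \<Rightarrow> enat" where
  "val_exp l x = (if x = 0 then \<infinity> else enat (multiplicity (int l) x))"

definition l_ordering :: "int set \<Rightarrow> nat \<Rightarrow> (nat \<Rightarrow> int) \<Rightarrow> bool" where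
  "l_ordering S l a \<longleftrightarrow>
     (\<forall>k. a k \<in> S) \<and>
     (\<forall>k\<ge>1. \<forall>x\<in>S. val_exp l (\<Prod>i<k. a k - a i) \<le> val_exp l (\<Prod>i<k. x - a i))"

text \<open>
  By Bhargava's theorem the value does not depend on the \<open>l\<close>-ordering, so an arbitrary one is
  chosen.  For infinite \<open>S\<close> and prime \<open>l\<close> orderings exist and the product below is nonzero, so that
  \<^const>\<open>multiplicity\<close> is its honest exponent.
\<close>

definition bhargava_nu :: "int set \<Rightarrow> nat \<Rightarrow> nat \<Rightarrow> nat" where
  "bhargava_nu S l k =
     (let a = (SOME a. l_ordering S l a) in l ^ multiplicity (int l) (\<Prod>i<k. a k - a i))"

text \<open>
  \<^const>\<open>Prod_any\<close> is the product over the whole type of a function that equals \<open>1\<close> at all but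
  finitely many arguments.  For infinite \<open>S\<close> only finitely many primes \<open>l\<close> have \<open>\<nu>\<^sub>k(S,l) \<noteq> 1\<close>,
  because each such \<open>l\<close> divides \<open>\<Prod>i<j. x j - x i\<close> for some \<open>j \<le> k\<close>, for any fixed distinct
  \<open>x 0, \<dots>, x k\<close> in \<open>S\<close>.
\<close>

definition bhargava_fact :: "int set \<Rightarrow> nat \<Rightarrow> nat" where
  "bhargava_fact S k = Prod_any (\<lambda>l. if prime l then bhargava_nu S l k else 1)"

section \<open>The complex of linearly independent sets\<close>

text \<open>
  A simplicial complex is given by its set of nonempty simplices.  The condition
  \<open>\<sigma> \<subseteq> carrier_vec n - {0}\<close> says that the vertices are nonzero vectors of length \<open>n\<close>.
\<close>

definition unimodular_complex :: "nat \<Rightarrow> 'a::field vec set set" where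
  "unimodular_complex n =
     {\<sigma>. \<sigma> \<subseteq> carrier_vec n - {0\<^sub>v n} \<and> finite \<sigma> \<and> \<sigma> \<noteq> {} \<and>
         module.lin_indpt class_ring (module_vec TYPE('a) n) \<sigma>}"

definition f_num :: "'v set set \<Rightarrow> nat \<Rightarrow> nat" where
  "f_num K i = card {\<sigma> \<in> K. card \<sigma> = i + 1}"

end

theory Submission
  imports Defs "Berlekamp_Zassenhaus.Berlekamp_Type_Based"
begin

text \<open>
  Both sides of the identity are \<open>(p\<^sup>k - 1) (p\<^sup>k - p) \<dots> (p\<^sup>k - p\<^bsup>k-1\<^esup>) / k!\<close>.

  On the factorial side, suppose that a sequence \<open>b\<close> of distinct elements of \<open>S\<close> is such that
  \<open>\<Prod>i<k. b k - b i\<close> divides \<open>\<Prod>i<k. x - b i\<close> for every \<open>x \<in> S\<close> and every \<open>k\<close>.  Then \<open>b\<close> is an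
  \<open>l\<close>-ordering for all primes \<open>l\<close> at once, and multiplying the prime powers
  \<open>\<nu>\<^sub>k(S,l)\<close> gives back \<open>\<bar>\<Prod>i<k. b k - b i\<bar>\<close> (\<open>bhargava_fact_eq_prod\<close>).  For \<open>S = \<int>\<close> the sequence
  \<open>0, 1, 2, \<dots>\<close> has this property because binomial coefficients are integers, and the factorial is
  \<open>k!\<close>.  For the powers of \<open>q\<close> the sequence \<open>1, q, q\<^sup>2, \<dots>\<close> has it because Gaussian binomial
  coefficients are integers, and the factorial is \<open>\<Prod>i<k. q\<^sup>k - q\<^sup>i\<close>.

  Since \<open>\<nu>\<^sub>k(S,l)\<close> is read off from an unspecified \<open>l\<close>-ordering, this argument needs Bhargava's theorem
  that all \<open>l\<close>-orderings give the same value (\<open>multiplicity_l_ordering_unique\<close>).  The reason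
  is that \<open>\<nu>\<^sub>k(S,l)\<close> has a description without orderings: it is the largest power of \<open>l\<close> that
  divides all values on \<open>S\<close> of some product \<open>(x - b\<^sub>0) \<dots> (x - b\<^bsub>k-1\<^esub>)\<close>.  The product that belongs to the
  ordering itself attains this power by minimality; that no other product exceeds it is seen by
  expanding the product in the Newton basis of the ordering.

  On the geometric side, an independent set of \<open>j\<close> vectors in \<open>\<F>\<^sub>q\<^sup>n\<close> spans \<open>q\<^sup>j\<close> vectors and so has
  \<open>q\<^sup>n - q\<^sup>j\<close> one-vector extensions, while each independent set of \<open>j + 1\<close> vectors arises in this way from
  \<open>j + 1\<close> pairs.  By induction, \<open>j!\<close> times the number of independent \<open>j\<close>-sets is
  \<open>\<Prod>i<j. q\<^sup>n - q\<^sup>i\<close> (\<open>fact_mult_card_independent_sets\<close>); the theorem is the case \<open>j = n = k\<close>.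
\<close>

section \<open>Independence of the ordering\<close>

text \<open>
  The leading Newton coefficient is \<open>1\<close> because the product is monic, and no denominators occur
  because the induction only rewrites \<open>x - b k\<close> as \<open>(x - a j) + (a j - b k)\<close>.
\<close>


lemma newton_expansion_of_product:
  fixes a b :: "nat \<Rightarrow> 'a::comm_ring_1"
  shows "\<exists>c. c k = 1 \<and> (\<forall>x. (\<Prod>i<k. x - b i) = (\<Sum>j\<le>k. c j * (\<Prod>i<j. x - a i)))"
proof (induction k)
  case 0
  show ?case by (intro exI[of _ "\<lambda>_. 1"]) simp
next
  case (Suc k)
  then obtain c where c: "c k = 1"
    and expand: "\<And>x. (\<Prod>i<k. x - b i) = (\<Sum>j\<le>k. c j * (\<Prod>i<j. x - a i))"
    by blast
  define d where "d j = (if j \<le> k then c j * (a j - b k) else 0) + (if j = 0 then 0 else c (j - 1))" for j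
  have "d (Suc k) = 1"
    by (simp add: d_def c)
  moreover have "(\<Prod>i<Suc k. x - b i) = (\<Sum>j\<le>Suc k. d j * (\<Prod>i<j. x - a i))" for x
  proof -
    let ?P = "\<lambda>j. \<Prod>i<j. x - a i"
    have "(\<Prod>i<Suc k. x - b i) = (\<Sum>j\<le>k. c j * ?P j * (x - b k))"
      by (simp add: expand sum_distrib_right)
    also have "\<dots> = (\<Sum>j\<le>k. c j * (a j - b k) * ?P j + c j * ?P (Suc j))"
      by (intro sum.cong) (simp_all add: algebra_simps)
    also have "\<dots> = (\<Sum>j\<le>k. c j * (a j - b k) * ?P j) + (\<Sum>j\<le>k. c j * ?P (Suc j))"
      by (rule sum.distrib)
    also have "(\<Sum>j\<le>k. c j * ?P (Suc j)) = (\<Sum>j\<le>Suc k. (if j = 0 then 0 else c (j - 1)) * ?P j)"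
      by (subst sum.atMost_Suc_shift) simp
    also have "(\<Sum>j\<le>k. c j * (a j - b k) * ?P j) =
        (\<Sum>j\<le>Suc k. (if j \<le> k then c j * (a j - b k) else 0) * ?P j)"
      by simp
    finally show ?thesis
      unfolding d_def distrib_right sum.distrib .
  qed
  ultimately show ?case by blast
qed

text \<open>
  With a cofactor \<open>c\<close> in place, minimality of valuations can be applied to single terms of a Newton
  expansion.
\<close>

lemma val_exp_le_imp_power_dvd:
  assumes l: "prime l" and le: "val_exp l u \<le> val_exp l v" and dvd: "int l ^ e dvd c * u"
  shows "int l ^ e dvd c * v"
proof (cases "c = 0 \<or> v = 0")
  case False
  then have nz: "c \<noteq> 0" "v \<noteq> 0" "u \<noteq> 0"
    using le by (auto simp: val_exp_def split: if_splits)
  have pe: "prime_elem (int l)" and nu: "\<not> is_unit (int l)"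
    using l by (auto simp: prime_imp_prime_elem dest: prime_gt_1_nat)
  have "multiplicity (int l) u \<le> multiplicity (int l) v"
    using le nz by (simp add: val_exp_def)
  then show ?thesis
    using dvd nz pe nu by (simp add: power_dvd_iff_le_multiplicity prime_elem_multiplicity_mult_distrib)
qed auto

text \<open>
  Evaluating the Newton expansion at \<open>a j\<close> kills all terms beyond the \<open>j\<close>-th.  Hence, inductively, every
  term takes values divisible by \<open>l\<^sup>e\<close>: at \<open>a j\<close> by subtracting the earlier terms, and then at every
  point of \<open>S\<close> since \<open>a j\<close> minimises the valuation of the \<open>j\<close>-th Newton polynomial.  The conclusion is the
  last term, whose coefficient is \<open>1\<close>, at \<open>a k\<close>.
\<close>

lemma l_ordering_power_dvd_of_dvd_on_set:
  assumes l: "prime l" and a: "l_ordering S l a"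
    and f: "\<And>x. x \<in> S \<Longrightarrow> int l ^ e dvd (\<Prod>i<k. x - b i)"
  shows "int l ^ e dvd (\<Prod>i<k. a k - a i)"
proof -
  obtain c where c: "c k = 1"
    and expand: "\<And>x. (\<Prod>i<k. x - b i) = (\<Sum>j\<le>k. c j * (\<Prod>i<j. x - a i))"
    using newton_expansion_of_product[of k b a] by blast
  have aS: "a j \<in> S" for j
    using a by (simp add: l_ordering_def)
  have summand: "\<forall>x\<in>S. int l ^ e dvd c j * (\<Prod>i<j. x - a i)" if "j \<le> k" for j
    using that
  proof (induction j rule: less_induct)
    case (less j)
    let ?t = "\<lambda>m. c m * (\<Prod>i<m. a j - a i)"
    have "(\<Prod>i<k. a j - b i) = (\<Sum>m\<le>k. ?t m)"
      by (rule expand)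
    also have "\<dots> = (\<Sum>m\<le>j. ?t m)"
      using less.prems by (intro sum.mono_neutral_right) (auto simp: prod_zero_iff)
    also have "\<dots> = ?t j + (\<Sum>m<j. ?t m)"
      by (simp add: lessThan_Suc_atMost[symmetric])
    finally have "?t j = (\<Prod>i<k. a j - b i) - (\<Sum>m<j. ?t m)"
      by simp
    moreover have "int l ^ e dvd (\<Sum>m<j. ?t m)"
      using less aS by (intro dvd_sum) auto
    ultimately have at: "int l ^ e dvd ?t j"
      using f[OF aS[of j]] by simp
    show ?case
    proof (cases "j = 0")
      case True
      with at show ?thesis by simp
    next
      case False
      then have "\<forall>x\<in>S. val_exp l (\<Prod>i<j. a j - a i) \<le> val_exp l (\<Prod>i<j. x - a i)"
        using a by (simp add: l_ordering_def)
      with at show ?thesis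
        using val_exp_le_imp_power_dvd[OF l] by blast
    qed
  qed
  show ?thesis
    using summand[of k] aS[of k] c by simp
qed

lemma l_ordering_prod_dvd_on_set:
  assumes l: "prime l" and a: "l_ordering S l a" and "x \<in> S"
    and dvd: "int l ^ e dvd (\<Prod>i<k. a k - a i)"
  shows "int l ^ e dvd (\<Prod>i<k. x - a i)"
proof (cases "k = 0")
  case False
  with a \<open>x \<in> S\<close> have "val_exp l (\<Prod>i<k. a k - a i) \<le> val_exp l (\<Prod>i<k. x - a i)"
    by (simp add: l_ordering_def)
  then show ?thesis
    using val_exp_le_imp_power_dvd[OF l, where c = 1] dvd by simp
qed (use dvd in simp)

text \<open>
  A power of \<open>l\<close> dividing the product at stage \<open>k\<close> of one ordering divides the corresponding
  polynomial on all of \<open>S\<close>, hence also the product at stage \<open>k\<close> of any other ordering.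
\<close>

theorem multiplicity_l_ordering_unique:
  assumes l: "prime l" and a: "l_ordering S l a" and b: "l_ordering S l b"
  shows "multiplicity (int l) (\<Prod>i<k. a k - a i) = multiplicity (int l) (\<Prod>i<k. b k - b i)"
proof -
  have "int l ^ e dvd (\<Prod>i<k. a k - a i) \<longleftrightarrow> int l ^ e dvd (\<Prod>i<k. b k - b i)" for e
  proof
    assume "int l ^ e dvd (\<Prod>i<k. a k - a i)"
    then have "int l ^ e dvd (\<Prod>i<k. x - a i)" if "x \<in> S" for x
      using l_ordering_prod_dvd_on_set[OF l a that] by simp
    then show "int l ^ e dvd (\<Prod>i<k. b k - b i)"
      by (rule l_ordering_power_dvd_of_dvd_on_set[OF l b])
  next
    assume "int l ^ e dvd (\<Prod>i<k. b k - b i)"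
    then have "int l ^ e dvd (\<Prod>i<k. x - b i)" if "x \<in> S" for x
      using l_ordering_prod_dvd_on_set[OF l b that] by simp
    then show "int l ^ e dvd (\<Prod>i<k. a k - a i)"
      by (rule l_ordering_power_dvd_of_dvd_on_set[OF l a])
  qed
  then show ?thesis
    by (simp add: multiplicity_def)
qed

section \<open>Simultaneous orderings\<close>

lemma bhargava_nu_l_ordering:
  assumes "prime l" and "l_ordering S l b"
  shows "bhargava_nu S l k = l ^ multiplicity (int l) (\<Prod>i<k. b k - b i)"
proof -
  have "l_ordering S l (SOME a. l_ordering S l a)"
    using assms(2) by (rule someI[of "l_ordering S l"])
  then show ?thesis
    using multiplicity_l_ordering_unique[OF assms(1) _ assms(2)]
    unfolding bhargava_nu_def Let_def by simp
qed

lemma l_ordering_of_dvd: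
  assumes "prime l" and "inj b" and "range b \<subseteq> S"
    and "\<And>x k. x \<in> S \<Longrightarrow> (\<Prod>i<k. b k - b i) dvd (\<Prod>i<k. x - b i)"
  shows "l_ordering S l b"
proof -
  have "val_exp l (\<Prod>i<k. b k - b i) \<le> val_exp l (\<Prod>i<k. x - b i)" if x: "x \<in> S" for k x
  proof (cases "(\<Prod>i<k. x - b i) = 0")
    case False
    have "(\<Prod>i<k. b k - b i) \<noteq> 0"
      using \<open>inj b\<close> by (auto dest: injD)
    then show ?thesis
      using False assms(4)[OF x, of k] by (simp add: val_exp_def dvd_imp_multiplicity_le)
  qed (simp add: val_exp_def)
  then show ?thesis
    using assms(3) by (auto simp: l_ordering_def)
qed

text \<open>
  Each \<open>\<nu>\<^sub>k(S,l)\<close> is the exact power of \<open>l\<close> in the same nonzero integer, so their product is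
  the prime factorisation of its absolute value.
\<close>

theorem bhargava_fact_eq_prod:
  assumes b: "inj b" "range b \<subseteq> S"
    and dvd: "\<And>x k. x \<in> S \<Longrightarrow> (\<Prod>i<k. b k - b i) dvd (\<Prod>i<k. x - b i)"
  shows "int (bhargava_fact S k) = \<bar>\<Prod>i<k. b k - b i\<bar>"
proof -
  let ?N = "nat \<bar>\<Prod>i<k. b k - b i\<bar>"
  have "(\<Prod>i<k. b k - b i) \<noteq> 0"
    using b(1) by (auto dest: injD)
  then have nz: "?N > 0" by simp
  have nu: "bhargava_nu S l k = l ^ multiplicity l ?N" if "prime l" for l
  proof -
    have "multiplicity (int l) (\<Prod>i<k. b k - b i) = multiplicity l ?N"
      by (simp add: multiplicity_def dvd_nat_abs_iff)
    then show ?thesis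
      using bhargava_nu_l_ordering[OF that l_ordering_of_dvd[OF that b dvd]] by simp
  qed
  have "bhargava_fact S k = Prod_any (\<lambda>l. if prime l then l ^ multiplicity l ?N else 1)"
    unfolding bhargava_fact_def by (intro Prod_any.cong) (simp add: nu)
  also have "\<dots> = (\<Prod>l\<in>prime_factors ?N. if prime l then l ^ multiplicity l ?N else 1)"
    using nz by (intro Prod_any.expand_superset)
      (auto simp: in_prime_factors_iff not_dvd_imp_multiplicity_0 intro: ccontr)
  also have "\<dots> = (\<Prod>l\<in>prime_factors ?N. l ^ multiplicity l ?N)"
    by (intro prod.cong) auto
  also have "\<dots> = ?N"
    using nz prod_prime_factors[of ?N] by simp
  finally show ?thesis by simp
qed

lemma bhargava_fact_UNIV: "bhargava_fact UNIV k = fact k"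
proof -
  have fact_eq: "(\<Prod>i<m. int m - int i) = fact m" for m
    by (simp add: fact_prod_rev atLeast0LessThan of_nat_diff)
  have "int (bhargava_fact UNIV k) = \<bar>\<Prod>i<k. int k - int i\<bar>"
  proof (rule bhargava_fact_eq_prod)
    fix x :: int and m :: nat
    have "(\<Prod>i<m. x - int i) = (- 1) ^ m * pochhammer (- x) m"
      using falling_fact_pochhammer[of x m] by (simp add: atLeast0LessThan)
    then show "(\<Prod>i<m. int m - int i) dvd (\<Prod>i<m. x - int i)"
      unfolding fact_eq by (simp add: fact_dvd_pochhammer)
  qed (auto simp: inj_def)
  then have "int (bhargava_fact UNIV k) = int (fact k)"
    unfolding fact_eq by simp
  then show ?thesis by (simp only: of_nat_eq_iff)
qed

text \<open>The step from \<open>(m, k)\<close> to \<open>(m + 1, k + 1)\<close> splits off \<open>i = 0\<close> and a factor \<open>q\<close> from the other terms.\<close>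

lemma q_falling_prod_Suc:
  fixes q :: "'a::comm_ring_1"
  shows "(\<Prod>i<Suc k. q ^ Suc m - q ^ i) = (q ^ Suc m - 1) * q ^ k * (\<Prod>i<k. q ^ m - q ^ i)"
proof -
  have "(\<Prod>i<k. q ^ Suc m - q ^ Suc i) = (\<Prod>i<k. q * (q ^ m - q ^ i))"
    by (simp add: algebra_simps)
  also have "\<dots> = q ^ k * (\<Prod>i<k. q ^ m - q ^ i)"
    by (simp add: prod.distrib)
  finally show ?thesis
    by (subst prod.lessThan_Suc_shift) (simp add: algebra_simps)
qed

text \<open>
  The cofactor is the Gaussian binomial coefficient \<open>[m, k]\<^sub>q\<close>.  That it lies in the ring follows from its
  Pascal recurrence, which is carried out on the numerators here to avoid division.
\<close>

lemma q_falling_prod_dvd: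
  fixes q :: "'a::comm_ring_1"
  shows "(\<Prod>i<k. q ^ k - q ^ i) dvd (\<Prod>i<k. q ^ m - q ^ i)"
proof (induction m arbitrary: k)
  case 0
  have "(\<Prod>i<k. q ^ 0 - q ^ i) = 0" if "k > 0"
    using that by (intro prod_zero bexI[of _ 0]) auto
  then show ?case by (cases "k = 0") auto
next
  case (Suc m)
  show ?case
  proof (cases k)
    case (Suc j)
    let ?G = "\<lambda>m k. \<Prod>i<k. q ^ m - q ^ i"
    \<comment> \<open>Numerator form of \<open>[m + 1, j + 1] = q\<^bsup>j+1\<^esup> [m, j + 1] + [m, j]\<close>.\<close>
    have "?G (Suc m) (Suc j) = q ^ Suc j * ?G m (Suc j) + q ^ j * (q ^ Suc j - 1) * ?G m j"
      unfolding q_falling_prod_Suc by (simp add: algebra_simps)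
    moreover have "?G (Suc j) (Suc j) dvd q ^ j * (q ^ Suc j - 1) * ?G m j"
      using mult_dvd_mono[OF dvd_refl Suc.IH[of j], of "q ^ j * (q ^ Suc j - 1)"]
      unfolding q_falling_prod_Suc by (simp add: mult_ac)
    ultimately show ?thesis
      using Suc.IH[of "Suc j"] unfolding Suc by (simp add: dvd_add dvd_mult)
  qed simp
qed

lemma bhargava_fact_powers:
  assumes "q > 1"
  shows "bhargava_fact (range (\<lambda>j. int q ^ j)) k = (\<Prod>i<k. q ^ k - q ^ i)"
proof -
  have "inj (\<lambda>j. int q ^ j)"
    using assms by (auto simp: inj_def)
  then have "int (bhargava_fact (range (\<lambda>j. int q ^ j)) k) = \<bar>\<Prod>i<k. int q ^ k - int q ^ i\<bar>"
    by (rule bhargava_fact_eq_prod) (auto simp: q_falling_prod_dvd)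
  also have "(\<Prod>i<k. int q ^ k - int q ^ i) = int (\<Prod>i<k. q ^ k - q ^ i)"
    using assms by (simp add: of_nat_diff power_increasing)
  finally show ?thesis by (simp only: abs_of_nat of_nat_eq_iff)
qed

section \<open>Counting independent sets over a finite field\<close>

locale finite_vec_space = vec_space f_ty n
  for f_ty :: "'a::{field,finite} itself" and n
begin

definition independent_sets :: "nat \<Rightarrow> 'a vec set set" where
  "independent_sets j = {A. A \<subseteq> carrier_vec n \<and> finite A \<and> card A = j \<and> lin_indpt A}"

text \<open>Independence makes the map from coefficient families to linear combinations injective.\<close>

lemma card_span_independent:
  assumes "A \<in> independent_sets j"
  shows "card (span A) = CARD('a) ^ j"
proof -
  have A: "A \<subseteq> carrier_vec n" "finite A" "card A = j" "lin_indpt A"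
    using assms by (auto simp: independent_sets_def)
  let ?F = "A \<rightarrow>\<^sub>E (UNIV :: 'a set)"
  have "span A = (\<lambda>a. lincomb a A) ` (A \<rightarrow> UNIV)"
    using finite_span[OF A(2)] A(1) by auto
  also have "\<dots> = (\<lambda>a. lincomb a A) ` ?F"
  proof -
    have "lincomb a A = lincomb (restrict a A) A" for a
      by (rule lincomb_cong) (use A in auto)
    moreover have "restrict a A \<in> ?F" for a
      by simp
    ultimately have "(\<lambda>a. lincomb a A) ` (A \<rightarrow> UNIV) \<subseteq> (\<lambda>a. lincomb a A) ` ?F"
      by (metis (no_types, lifting) image_eqI image_subsetI)
    then show ?thesis by auto
  qed
  finally have span: "span A = (\<lambda>a. lincomb a A) ` ?F" .
  have "inj_on (\<lambda>a. lincomb a A) ?F"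
  proof (rule inj_onI)
    fix a b assume a: "a \<in> ?F" and b: "b \<in> ?F" and eq: "lincomb a A = lincomb b A"
    have "lincomb (\<lambda>v. a v - b v) A = 0\<^sub>v n"
    proof (rule eq_vecI)
      fix i assume "i < dim_vec (0\<^sub>v n :: 'a vec)"
      then have i: "i < n" by simp
      have "lincomb (\<lambda>v. a v - b v) A $ i = lincomb a A $ i - lincomb b A $ i"
        using lincomb_index[OF i A(1)] by (simp add: left_diff_distrib sum_subtractf)
      then show "lincomb (\<lambda>v. a v - b v) A $ i = 0\<^sub>v n $ i"
        using eq i by simp
    qed (use lincomb_dim[OF A(2,1)] in simp)
    then have "(\<lambda>v. a v - b v) \<in> A \<rightarrow> {0}"
      using not_lindepD[OF A(4,2) subset_refl, of "\<lambda>v. a v - b v"] by simp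
    then show "a = b"
      using a b by (intro PiE_ext) (auto simp: Pi_iff)
  qed
  then have "card (span A) = card ?F"
    unfolding span by (rule card_image)
  also have "\<dots> = CARD('a) ^ j"
    using A by (simp add: card_PiE)
  finally show ?thesis .
qed

lemma finite_independent_sets: "finite (independent_sets j)"
  by (rule finite_subset[of _ "Pow (carrier_vec n)"]) (auto simp: independent_sets_def)

text \<open>
  Double counting: an independent set of size \<open>j + 1\<close> with a distinguished element is the same as an
  independent set of size \<open>j\<close> with a vector outside its span.
\<close>

lemma card_independent_sets_Suc:
  "Suc j * card (independent_sets (Suc j)) = card (independent_sets j) * (CARD('a) ^ n - CARD('a) ^ j)"
proof -
  let ?pointed = "SIGMA B:independent_sets (Suc j). B"
  let ?extension = "SIGMA A:independent_sets j. carrier_vec n - span A"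
  have "bij_betw (\<lambda>(A, v). (insert v A, v)) ?extension ?pointed"
  proof (rule bij_betwI[where g = "\<lambda>(B, v). (B - {v}, v)"])
    show "(\<lambda>(A, v). (insert v A, v)) \<in> ?extension \<rightarrow> ?pointed"
    proof safe
      fix A v
      assume A: "A \<in> independent_sets j" and v: "v \<in> carrier_vec n" "v \<notin> span A"
      then have "v \<notin> A"
        using span_mem by (auto simp: independent_sets_def)
      then show "insert v A \<in> independent_sets (Suc j)"
        using A v lin_dep_iff_in_span[of A v] by (auto simp: independent_sets_def)
    qed
    show "(\<lambda>(B, v). (B - {v}, v)) \<in> ?pointed \<rightarrow> ?extension"
    proof safe
      fix B v
      assume B: "B \<in> independent_sets (Suc j)" and v: "v \<in> B"
      have indep: "lin_indpt (B - {v})"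
        using B subset_li_is_li[of B "B - {v}"] by (auto simp: independent_sets_def)
      then show "B - {v} \<in> independent_sets j"
        using B v by (auto simp: independent_sets_def)
      show "v \<in> carrier_vec n"
        using B v by (auto simp: independent_sets_def)
      have "B - {v} \<union> {v} = B" using v by auto
      then show False if "v \<in> span (B - {v})"
        using that B v indep lin_dep_iff_in_span[of "B - {v}" v]
        by (auto simp: independent_sets_def)
    qed
    show "(\<lambda>(B, v). (B - {v}, v)) ((\<lambda>(A, v). (insert v A, v)) x) = x" if "x \<in> ?extension" for x
      using that span_mem by (force simp: independent_sets_def)
    show "(\<lambda>(A, v). (insert v A, v)) ((\<lambda>(B, v). (B - {v}, v)) y) = y" if "y \<in> ?pointed" for y
      using that by auto
  qed
  then have "card ?extension = card ?pointed"
    by (rule bij_betw_same_card)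
  moreover have "card ?pointed = Suc j * card (independent_sets (Suc j))"
    by (subst card_SigmaI) (auto simp: finite_independent_sets independent_sets_def)
  moreover have "card (carrier_vec n - span A) = CARD('a) ^ n - CARD('a) ^ j"
    if A: "A \<in> independent_sets j" for A
  proof -
    have "span A \<subseteq> carrier_vec n"
      using A span_closed by (auto simp: independent_sets_def)
    then show ?thesis
      using card_span_independent[OF A] card_carrier_vec[where 'b = 'a, of n]
      by (simp add: card_Diff_subset finite_subset)
  qed
  ultimately show ?thesis
    using finite_independent_sets by simp
qed

text \<open>
  The subtraction on naturals is harmless: for \<open>j > n\<close> the factor \<open>i = n\<close> vanishes, in agreement with the
  absence of independent sets of that size.
\<close>

theorem fact_mult_card_independent_sets:
  "fact j * card (independent_sets j) = (\<Prod>i<j. CARD('a) ^ n - CARD('a) ^ i)"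
proof (induction j)
  case 0
  have "independent_sets 0 = {{}}"
    by (auto simp: independent_sets_def lin_dep_def)
  then show ?case by simp
next
  case (Suc j)
  have "fact (Suc j) * card (independent_sets (Suc j)) =
      fact j * (Suc j * card (independent_sets (Suc j)))"
    by (simp only: fact_Suc of_nat_id mult_ac)
  also have "\<dots> = (fact j * card (independent_sets j)) * (CARD('a) ^ n - CARD('a) ^ j)"
    by (simp only: card_independent_sets_Suc mult.assoc)
  finally show ?case by (simp add: Suc.IH)
qed

lemma f_num_unimodular_complex:
  "f_num (unimodular_complex n :: 'a vec set set) i = card (independent_sets (Suc i))"
proof -
  have "0\<^sub>v n \<notin> A" if "A \<subseteq> carrier_vec n" "lin_indpt A" for A
  proof
    assume "0\<^sub>v n \<in> A"
    moreover have "lincomb (\<lambda>_. 1) {0\<^sub>v n} = 0\<^sub>v n"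
      by (rule eq_vecI) (simp_all add: lincomb_index lincomb_dim)
    ultimately have "lin_dep A"
      unfolding lin_dep_def
      by (intro exI[of _ "{0\<^sub>v n}"] exI[of _ "\<lambda>_. 1"] exI[of _ "0\<^sub>v n"]) simp
    with that show False by simp
  qed
  then have "{\<sigma> \<in> unimodular_complex n. card \<sigma> = i + 1} = independent_sets (Suc i)"
    unfolding unimodular_complex_def independent_sets_def by auto
  then show ?thesis by (simp add: f_num_def)
qed

end

theorem lemma6p4:
  fixes p k :: nat and S T :: "int set"
  assumes "prime p" and "CARD('p::prime_card) = p"
    and "S = UNIV" and "T = range (\<lambda>j::nat. int p ^ j)"
    and "k > 0"
  shows "rat_of_nat (bhargava_fact T k) / rat_of_nat (bhargava_fact S k)
       = rat_of_nat (f_num (unimodular_complex k :: 'p mod_ring vec set set) (k - 1))"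
proof -
  interpret finite_vec_space "TYPE('p mod_ring)" k .
  have "bhargava_fact T k = (\<Prod>i<k. p ^ k - p ^ i)"
    using assms bhargava_fact_powers prime_gt_1_nat by blast
  also have "\<dots> = fact k * card (independent_sets k)"
    using fact_mult_card_independent_sets[of k] assms(2) by simp
  also have "\<dots> = bhargava_fact S k * f_num (unimodular_complex k :: 'p mod_ring vec set set) (k - 1)"
    using assms by (simp add: bhargava_fact_UNIV f_num_unimodular_complex)
  finally show ?thesis
    using assms(3) by (simp add: bhargava_fact_UNIV)
qed

end
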